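(* Let $C_r$ ($r\ge 3$) be the directed cycle of length $r$. Then (a) $\chi^*_o(C_r)=3$ if $r\equiv 0 \pmod 3$; (b) $\chi^*_o(C_4)=4$; (c) $\chi^*_o(C_5)=5$; (d) $\chi^*_o(C_r)=4-\beta(r)$ if $r>5$ and $r\not\equiv 0\pmod 3$.
   Context: The directed cycle $C_r$ has vertices $u_i$, $i\in\mathbb{Z}/r\mathbb{Z}$, and arcs $u_iu_{i+1}$ (indices mod $r$). For a set $S$ of $k$ colors, a $b$-fold oriented $k$-coloring of an oriented graph $G$ is a map $f$ from $V(G)$ to the $b$-element subsets of $S$ such that (i) $f(x)\cap f(y)=\emptyset$ for every arc $xy$, and (ii) for all arcs $xy, zw$, $f(x)\cap f(w)\neq\emptyset$ implies $f(y)\cap f(z)=\emptyset$. $\chi^b_o(G)$ is the minimum such $k$, and $\chi^*_o(G)=\lim_{b\to\infty}\chi^b_o(G)/b=\inf_{b\ge1}\chi^b_o(G)/b$. A prime $p>3$ is type-A if $p\equiv 3 \pmod 4$. For an integer $r>5$: $\beta(r)=0$ if $r$ has no type-A prime factor, and otherwise $\beta(r)=\frac{4}{p+1}$ where $p$ is the least type-A prime factor of $r$. *)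

theory Defs
  imports "HOL-Computational_Algebra.Primes" Complex_Main
begin

text \<open>An oriented graph is given by a vertex set V and an arc set A.
  A b-fold oriented k-coloring uses the colour set S = {0..<k} (any k-element set
  is equivalent up to renaming).\<close>

definition bfold_oriented_coloring ::
  "'a set \<Rightarrow> ('a \<times> 'a) set \<Rightarrow> nat \<Rightarrow> nat \<Rightarrow> ('a \<Rightarrow> nat set) \<Rightarrow> bool" where
  "bfold_oriented_coloring V A b k f \<longleftrightarrow>
     (\<forall>v\<in>V. f v \<subseteq> {..<k} \<and> card (f v) = b) \<and>
     (\<forall>(x, y)\<in>A. f x \<inter> f y = {}) \<and>
     (\<forall>(x, y)\<in>A. \<forall>(z, w)\<in>A. f x \<inter> f w \<noteq> {} \<longrightarrow> f y \<inter> f z = {})"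

definition chi_o_b :: "'a set \<Rightarrow> ('a \<times> 'a) set \<Rightarrow> nat \<Rightarrow> nat" where
  "chi_o_b V A b = (LEAST k. \<exists>f. bfold_oriented_coloring V A b k f)"

definition chi_o_star :: "'a set \<Rightarrow> ('a \<times> 'a) set \<Rightarrow> real" where
  "chi_o_star V A = (INF b\<in>{b::nat. 1 \<le> b}. real (chi_o_b V A b) / real b)"

definition cyc_V :: "nat \<Rightarrow> nat set" where
  "cyc_V r = {..<r}"

definition cyc_A :: "nat \<Rightarrow> (nat \<times> nat) set" where
  "cyc_A r = {(i, Suc i mod r) | i. i < r}"

definition typeA_prime :: "nat \<Rightarrow> bool" where
  "typeA_prime p \<longleftrightarrow> prime p \<and> p > 3 \<and> p mod 4 = 3"

definition beta :: "nat \<Rightarrow> real" where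
  "beta r = (if \<exists>p. typeA_prime p \<and> p dvd r
             then 4 / (real (LEAST p. typeA_prime p \<and> p dvd r) + 1)
             else 0)"

end

theory Submission
  imports Defs
begin

text \<open>
  Let A(x) be the colour set of vertex x (mod r) in a b-fold colouring with k < 4b colours. Call a
  distance e meeting if A(x) and A(x+e) intersect for all x, and avoiding if they are
  disjoint for all x. By the orientation condition, e-2 and e+2 are avoiding whenever e is
  meeting; and since four b-sets cannot be pairwise disjoint, enough avoiding distances force a
  meeting one. Starting from 0 meeting and 1, 2 avoiding, this determines the status
  of every distance: for some n = 4K+3 it depends only on the residue mod n, the meeting residues
  being 0, 3, 4, 7, 8, \<dots>, 4K-1, 4K. As r is meeting and r-1, r+1 are avoiding, n divides r. Inside n
  consecutive vertices a colour then occurs at most K+1 times, so n b \<le> k (K+1), that is,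
  k/b \<ge> 4 - 4/(n+1). Conversely, if n = 4m-1 divides r, the intervals
  {mx, \<dots>, mx+m-1} in the integers mod n form an m-fold colouring with n colours.
\<close>

section \<open>Distances in a colouring of a directed cycle\<close>

text \<open>Vertices run over all naturals with period \<open>r\<close>, so distances may exceed
  \<open>r\<close>.\<close>

locale cyclic_coloring =
  fixes r b k :: nat and A :: "nat \<Rightarrow> nat set"
  assumes r_pos: "0 < r" and b_pos: "0 < b"
    and periodic: "A (x + r) = A x"
    and colors: "A x \<subseteq> {..<k}"
    and card_A: "card (A x) = b"
    and disjoint_Suc: "A x \<inter> A (Suc x) = {}"
    and oriented: "A x \<inter> A (Suc z) \<noteq> {} \<Longrightarrow> A (Suc x) \<inter> A z = {}"
begin

text \<open>Both notions quantify over every \<open>x\<close>, so \<open>avoids e\<close> says more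
  than the failure of \<open>meets e\<close>.\<close>

definition meets :: "nat \<Rightarrow> bool" where
  "meets e \<longleftrightarrow> (\<forall>x. A x \<inter> A (x + e) \<noteq> {})"

definition avoids :: "nat \<Rightarrow> bool" where
  "avoids e \<longleftrightarrow> (\<forall>x. A x \<inter> A (x + e) = {})"

lemma avoidsD: "avoids e \<Longrightarrow> A x \<inter> A (x + e) = {}"
  by (simp add: avoids_def)

lemma meetsD: "meets e \<Longrightarrow> A x \<inter> A (x + e) \<noteq> {}"
  by (simp add: meets_def)

lemma not_meets_avoids: "meets e \<Longrightarrow> avoids e \<Longrightarrow> False"
  by (auto simp: meets_def avoids_def)

lemma finite_A: "finite (A x)"
  using colors finite_subset by blast

lemma meets_0: "meets 0"
proof -
  have "A x \<noteq> {}" for x using card_A[of x] b_pos by auto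
  then show ?thesis by (simp add: meets_def)
qed

lemma avoids_1: "avoids 1"
  using disjoint_Suc by (simp add: avoids_def)

text \<open>Apply orientation to the arc leaving \<open>x\<close> and the arc entering
  \<open>x + e + 2\<close>: their inner ends are at distance \<open>e\<close>.\<close>

lemma meets_imp_avoids_add2:
  assumes "meets e" shows "avoids (e + 2)"
  unfolding avoids_def
proof (intro allI, rule ccontr)
  fix x assume "A x \<inter> A (x + (e + 2)) \<noteq> {}"
  then have "A (Suc x) \<inter> A (Suc x + e) = {}"
    using oriented[of x "Suc x + e"] by simp
  then show False using meetsD[OF assms] by blast
qed

lemma meets_add2_imp_avoids:
  assumes "meets (e + 2)" shows "avoids e"
  unfolding avoids_def
proof (intro allI, rule ccontr)
  fix x assume ne: "A x \<inter> A (x + e) \<noteq> {}"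
  \<comment> \<open>The vertex 0 has no predecessor in the naturals, so shift by one period
    first.\<close>
  obtain y where y: "x + r = Suc y" using r_pos by (cases "x + r") auto
  have "A (x + r) \<inter> A (x + r + e) \<noteq> {}"
    using ne periodic[of x] periodic[of "x + e"] by (simp add: ac_simps)
  then have "A (Suc y) \<inter> A (Suc y + e) \<noteq> {}" unfolding y .
  then have "A y \<inter> A (Suc (Suc y + e)) = {}"
    using oriented[of y "Suc y + e"] by blast
  then show False using meetsD[OF assms, of y] by simp
qed

lemma avoids_2: "avoids 2"
  using meets_imp_avoids_add2[OF meets_0] by (simp add: numeral_2_eq_2)

lemma meets_r: "meets r"
  using meets_0 periodic by (simp add: meets_def)

lemma avoids_Suc_r: "avoids (Suc r)"
proof -
  have "A (x + Suc r) = A (Suc x)" for x using periodic[of "Suc x"] by simp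
  then show ?thesis using disjoint_Suc by (simp add: avoids_def)
qed

lemma avoids_r_minus_1: "avoids (r - 1)"
  unfolding avoids_def
proof
  fix x
  have "Suc (x + (r - 1)) = x + r" using r_pos by simp
  then show "A x \<inter> A (x + (r - 1)) = {}"
    using disjoint_Suc[of "x + (r - 1)"] periodic[of x] by auto
qed

lemma three_sets_bound: "3 * b \<le> k"
proof -
  have d: "A 0 \<inter> A 1 = {}" "A 0 \<inter> A 2 = {}" "A 1 \<inter> A 2 = {}"
    using avoidsD[OF avoids_1, of 0] avoidsD[OF avoids_2, of 0] avoidsD[OF avoids_1, of 1]
    by (simp_all add: numeral_2_eq_2)
  have "card (A 0 \<union> A 1 \<union> A 2) = 3 * b"
    using d by (simp add: card_Un_disjoint Int_Un_distrib2 finite_A card_A)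
  moreover have "card (A 0 \<union> A 1 \<union> A 2) \<le> card {..<k}"
    using colors by (intro card_mono) auto
  ultimately show ?thesis by simp
qed

text \<open>In the 5-cycle any two vertices are at distance 1 or 2 in one direction, so all five
  sets are pairwise disjoint.\<close>

lemma five_sets_bound:
  assumes "r = 5" shows "5 * b \<le> k"
proof -
  have p: "A 5 = A 0" "A 6 = A 1" using periodic[of 0] periodic[of 1] assms by simp_all
  have d1: "A x \<inter> A y = {}" if "y = x + 1" for x y using avoidsD[OF avoids_1] that by simp
  have d2: "A x \<inter> A y = {}" if "y = x + 2" for x y using avoidsD[OF avoids_2] that by simp
  have "A 3 \<inter> A 5 = {}" "A 4 \<inter> A 5 = {}" "A 4 \<inter> A 6 = {}" by (simp_all add: d1 d2)
  then have d: "A 0 \<inter> A 3 = {}" "A 0 \<inter> A 4 = {}" "A 1 \<inter> A 4 = {}"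
    "A 0 \<inter> A 1 = {}" "A 0 \<inter> A 2 = {}" "A 1 \<inter> A 2 = {}" "A 1 \<inter> A 3 = {}"
    "A 2 \<inter> A 3 = {}" "A 2 \<inter> A 4 = {}" "A 3 \<inter> A 4 = {}"
    unfolding p by (blast, blast, blast) (simp_all add: d1 d2)
  have "card (A 0 \<union> A 1 \<union> A 2 \<union> A 3 \<union> A 4) = 5 * b"
    using d by (simp add: card_Un_disjoint Int_Un_distrib2 finite_A card_A)
  moreover have "card (A 0 \<union> A 1 \<union> A 2 \<union> A 3 \<union> A 4) \<le> card {..<k}"
    using colors by (intro card_mono) auto
  ultimately show ?thesis by simp
qed

end

section \<open>Fewer than 4b colours: forced meeting distances\<close>

locale sparse_cyclic_coloring = cyclic_coloring +
  assumes few_colors: "k < 4 * b"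
begin

lemma four_sets_intersect:
  assumes "A x \<inter> A y = {}" "A x \<inter> A z = {}" "A y \<inter> A z = {}"
    "A y \<inter> A t = {}" "A z \<inter> A t = {}"
  shows "A x \<inter> A t \<noteq> {}"
proof
  assume "A x \<inter> A t = {}"
  then have "card (A x \<union> A y \<union> A z \<union> A t) = 4 * b"
    using assms by (simp add: card_Un_disjoint Int_Un_distrib2 finite_A card_A)
  moreover have "card (A x \<union> A y \<union> A z \<union> A t) \<le> card {..<k}"
    using colors by (intro card_mono) auto
  ultimately show False using few_colors by simp
qed

text \<open>Among \<open>x\<close>, \<open>x + a\<close>, \<open>x + a + 1\<close>,
  \<open>x + a + 1 + d\<close>, five of the six distances are \<open>a\<close>,
  \<open>a + 1\<close>, \<open>1\<close>, \<open>d\<close>, \<open>d + 1\<close>, all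
  avoiding.\<close>

lemma meetsI:
  assumes "avoids a" "avoids (a + 1)" "avoids d" "avoids (d + 1)"
  shows "meets (a + 1 + d)"
  unfolding meets_def
proof
  fix x
  show "A x \<inter> A (x + (a + 1 + d)) \<noteq> {}"
    using avoidsD[OF assms(1), of x] avoidsD[OF assms(2), of x] avoidsD[OF assms(3), of "x + a + 1"]
      avoidsD[OF assms(4), of "x + a"] avoidsD[OF avoids_1, of "x + a"]
    by (intro four_sets_intersect[of x "x + a" "x + (a + 1)"]) (simp_all add: ac_simps)
qed

lemma pattern_of_meets_multiples_of_4:
  assumes "\<And>j. j \<le> K \<Longrightarrow> meets (4 * j)"
  shows "j \<le> K \<Longrightarrow> avoids (4 * j + 1) \<and> avoids (4 * j + 2) \<and> meets (4 * j + 3)"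
proof (induction j)
  case 0
  show ?case using meetsI[of 1 1] avoids_1 avoids_2 by (simp add: numeral_eq_Suc)
next
  case (Suc j)
  have m3: "meets (4 * j + 3)" using Suc by simp
  have a1: "avoids (4 * j + 5)" using meets_imp_avoids_add2[OF m3] by (simp add: numeral_eq_Suc)
  have a2: "avoids (4 * j + 6)"
    using meets_imp_avoids_add2[OF assms[OF Suc.prems]] by (simp add: numeral_eq_Suc)
  have "meets (1 + 1 + (4 * j + 5))"
    by (rule meetsI) (use a1 a2 avoids_1 avoids_2 in \<open>simp_all add: numeral_eq_Suc\<close>)
  with a1 a2 show ?case by (simp add: numeral_eq_Suc)
qed

text \<open>Otherwise the pattern repeats modulo 4 forever. Since \<open>r\<close> meets, its
  residue is 0 or 3; then \<open>r - 1\<close> or \<open>r + 1\<close> respectively would meet,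
  although both avoid.\<close>

lemma not_all_multiples_of_4_meet: "\<exists>j. \<not> meets (4 * j)"
proof (rule ccontr)
  assume "\<not> ?thesis"
  then have m0: "meets (4 * j)" for j by blast
  then have p: "avoids (4 * j + 1) \<and> avoids (4 * j + 2) \<and> meets (4 * j + 3)" for j
    using pattern_of_meets_multiples_of_4[of j j] by blast
  define j where "j = r div 4"
  have "r = 4 * j + r mod 4" by (simp add: j_def)
  moreover have "r mod 4 < 4" by simp
  ultimately consider "r = 4 * j" | "r = 4 * j + 1" | "r = 4 * j + 2" | "r = 4 * j + 3"
    by linarith
  then show False
  proof cases
    case 1
    then have "r - 1 = 4 * (j - 1) + 3" using r_pos by (cases j) auto
    then show False using p[of "j - 1"] avoids_r_minus_1 not_meets_avoids by metis
  next
    case 2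
    then show False using p[of j] meets_r not_meets_avoids by metis
  next
    case 3
    then show False using p[of j] meets_r not_meets_avoids by metis
  next
    case 4
    then have "Suc r = 4 * Suc j" by simp
    then show False using m0[of "Suc j"] avoids_Suc_r not_meets_avoids by metis
  qed
qed

text \<open>A disjoint pair A(x), A(x+n+1) makes A(x), A(x+n+3) meet (four sets), and then the next pair
  A(x+1), A(x+n+2) is disjoint by orientation.\<close>

lemma avoids_Suc_of_not_meets:
  assumes n: "meets n" and nm: "\<not> meets (n + 1)"
  shows "avoids (n + 1)"
proof -
  obtain x0 where x0: "A x0 \<inter> A (x0 + (n + 1)) = {}" using nm by (auto simp: meets_def)
  have a2: "avoids (n + 2)" using meets_imp_avoids_add2[OF n] .
  have step: "A (Suc x) \<inter> A (Suc x + (n + 1)) = {}" if "A x \<inter> A (x + (n + 1)) = {}" for x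
  proof -
    have "A x \<inter> A (x + n + 3) \<noteq> {}"
      using that avoidsD[OF a2, of x] avoidsD[OF avoids_1, of "x + (n + 1)"]
        avoidsD[OF avoids_2, of "x + (n + 1)"] avoidsD[OF avoids_1, of "x + (n + 2)"]
      by (intro four_sets_intersect[of x "x + (n + 1)" "x + (n + 2)"]) (simp_all add: numeral_eq_Suc)
    then show ?thesis using oriented[of x "x + n + 2"] by (simp add: numeral_eq_Suc)
  qed
  have later: "A (x0 + i) \<inter> A (x0 + i + (n + 1)) = {}" for i
  proof (induction i)
    case 0
    show ?case using x0 by simp
  next
    case (Suc i)
    show ?case using step[OF Suc] by simp
  qed
  have shift: "A (x + i * r) = A x" for x i
  proof (induction i)
    case (Suc i)
    then show ?case using periodic[of "x + i * r"] by (simp add: ac_simps)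
  qed simp
  show ?thesis
    unfolding avoids_def
  proof
    fix x
    \<comment> \<open>Disjointness was propagated only upwards from \<open>x0\<close>; adding
      \<open>x0\<close> periods lifts any \<open>x\<close> above \<open>x0\<close>.\<close>
    have "x0 \<le> x + x0 * r" using r_pos by (cases r) auto
    then obtain i where i: "x + x0 * r = x0 + i" using le_Suc_ex by blast
    have "A (x + x0 * r) \<inter> A (x + (n + 1) + x0 * r) = {}"
      using later[of i] unfolding i[symmetric] by (simp add: ac_simps)
    then show "A x \<inter> A (x + (n + 1)) = {}" unfolding shift .
  qed
qed

section \<open>Periodicity of the distances modulo 4K + 3\<close>

text \<open>The last distance, \<open>s + 4 * K + 3\<close>, is also the first of the next copy;
  hence the period is \<open>4 * K + 3\<close> and not \<open>4 * K + 4\<close>.\<close>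

definition pattern :: "nat \<Rightarrow> nat \<Rightarrow> bool" where
  "pattern K s \<longleftrightarrow> (\<forall>j\<le>K. meets (s + 4 * j) \<and> avoids (s + 4 * j + 1)
     \<and> avoids (s + 4 * j + 2) \<and> meets (s + 4 * j + 3))"

lemma patternD:
  assumes "pattern K s" "j \<le> K"
  shows "meets (s + 4 * j)" "avoids (s + 4 * j + 1)" "avoids (s + 4 * j + 2)" "meets (s + 4 * j + 3)"
  using assms by (auto simp: pattern_def)

text \<open>Take \<open>K + 1\<close> as the first \<open>j\<close> for which \<open>4 * j\<close>
  fails to meet. Since \<open>4 * K + 3\<close> meets, this failure is avoidance at every
  \<open>x\<close>.\<close>

lemma ex_first_pattern:
  obtains K where "pattern K 0" "avoids (4 * K + 4)"
proof -
  define j where "j = (LEAST j. \<not> meets (4 * j))"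
  have j: "\<not> meets (4 * j)" and less: "\<And>i. i < j \<Longrightarrow> meets (4 * i)"
    using not_all_multiples_of_4_meet LeastI_ex[of "\<lambda>j. \<not> meets (4 * j)"]
      not_less_Least[of _ "\<lambda>j. \<not> meets (4 * j)"] unfolding j_def by blast+
  then obtain K where K: "j = Suc K" using meets_0 by (cases j) auto
  have m0: "meets (4 * i)" if "i \<le> K" for i using less that K by simp
  then have pat: "pattern K 0"
    using pattern_of_meets_multiples_of_4[of K] by (simp add: pattern_def)
  have "meets (4 * K + 3)" using patternD(4)[OF pat, of K] by simp
  moreover have "\<not> meets (4 * K + 3 + 1)" using j K by (simp add: numeral_eq_Suc)
  ultimately have "avoids (4 * K + 3 + 1)" by (rule avoids_Suc_of_not_meets)
  then have "avoids (4 * K + 4)" by (simp add: numeral_eq_Suc)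
  with pat that show ?thesis by blast
qed

lemma pattern_step:
  assumes p0: "pattern K 0" and av: "avoids (4 * K + 4)" and p: "pattern K s"
  shows "pattern K (s + (4 * K + 3))"
proof -
  define t where "t = s + (4 * K + 3)"
  have t: "meets t" using patternD(4)[OF p, of K] by (simp add: t_def add.assoc)
  have main: "meets (t + 4 * j) \<and> avoids (t + 4 * j + 1)
     \<and> avoids (t + 4 * j + 2) \<and> meets (t + 4 * j + 3)" if "j \<le> K" for j
    using that
  proof (induction j)
    case 0
    \<comment> \<open>The avoiding pair \<open>4 * K + 4\<close>, \<open>4 * K + 5\<close> after the
      first copy combines with \<open>s + 1\<close>, \<open>s + 2\<close> to make
      \<open>t + 3\<close> meet; \<open>t + 1\<close> then avoids by going down 2.\<close>
    have "avoids (4 * K + 4 + 1)"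
      using meets_imp_avoids_add2[OF patternD(4)[OF p0, of K]] by (simp add: numeral_eq_Suc)
    then have "meets (4 * K + 4 + 1 + (s + 1))"
      using av patternD(2,3)[OF p, of 0] by (intro meetsI) (simp_all add: numeral_eq_Suc)
    then have m3: "meets (t + 3)" by (simp add: t_def numeral_eq_Suc ac_simps)
    moreover have "avoids (t + 1)"
      using m3 meets_add2_imp_avoids[of "t + 1"] by (simp add: numeral_eq_Suc)
    ultimately show ?case using t meets_imp_avoids_add2[OF t] by simp
  next
    case (Suc j)
    then have IH: "meets (t + 4 * j + 3)" by simp
    \<comment> \<open>Block \<open>Suc j\<close> of the initial pattern and the last block of the
      pattern at \<open>s\<close> each supply an avoiding pair.\<close>
    have "meets (4 * Suc j + 1 + 1 + (s + 4 * K + 1))"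
      using patternD(2,3)[OF p0 Suc.prems] patternD(2,3)[OF p order.refl]
      by (intro meetsI) (simp_all add: numeral_eq_Suc)
    then have m0: "meets (t + 4 * Suc j)" by (simp add: t_def numeral_eq_Suc ac_simps)
    have a1: "avoids (t + 4 * Suc j + 1)"
      using meets_imp_avoids_add2[OF IH] by (simp add: numeral_eq_Suc)
    have a2: "avoids (t + 4 * Suc j + 2)" using meets_imp_avoids_add2[OF m0] .
    have "meets (1 + 1 + (t + 4 * Suc j + 1))"
      using a1 a2 avoids_1 avoids_2 by (intro meetsI) (simp_all add: numeral_eq_Suc)
    then have "meets (t + 4 * Suc j + 3)" by (simp add: numeral_eq_Suc)
    with m0 a1 a2 show ?case by blast
  qed
  show ?thesis unfolding pattern_def t_def[symmetric] using main by blast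
qed

lemma pattern_multiples:
  assumes "pattern K 0" "avoids (4 * K + 4)"
  shows "pattern K ((4 * K + 3) * q)"
proof (induction q)
  case 0
  show ?case using assms(1) by simp
next
  case (Suc q)
  show ?case using pattern_step[OF assms Suc] by (simp add: add.commute)
qed

text \<open>Locate \<open>r\<close> in the copy starting at \<open>s\<close>, the largest multiple
  of the period up to \<open>r\<close>. As \<open>r\<close> meets and \<open>r - 1\<close>,
  \<open>r + 1\<close> avoid, only offset 0 is possible.\<close>

lemma period_dvd_r:
  assumes "pattern K 0" "avoids (4 * K + 4)"
  shows "(4 * K + 3) dvd r"
proof -
  define n where "n = 4 * K + 3"
  define s where "s = n * (r div n)"
  define j where "j = r mod n div 4"
  have p: "pattern K s" using pattern_multiples[OF assms] by (simp add: s_def n_def)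
  have sn: "r mod n < 4 * K + 3" by (simp add: n_def)
  have jK: "j \<le> K" using sn by (simp add: j_def)
  have split: "r mod n = 4 * j + r mod n mod 4" by (simp add: j_def)
  have r: "r = s + r mod n" by (simp add: s_def)
  have "r mod n mod 4 < 4" by simp
  with split consider "r mod n = 4 * j" | "r mod n = 4 * j + 1" | "r mod n = 4 * j + 2"
    | "r mod n = 4 * j + 3" by linarith
  then have "r mod n = 0"
  proof cases
    case 1
    show ?thesis
    proof (rule ccontr)
      assume "r mod n \<noteq> 0"
      with 1 obtain i where i: "j = Suc i" by (cases j) auto
      then have "meets (r - 1)"
        using patternD(4)[OF p, of i] jK r 1 by (simp add: numeral_eq_Suc)
      then show False using avoids_r_minus_1 not_meets_avoids by blast
    qed
  next
    case 2
    then show ?thesis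
      using patternD(2)[OF p jK] r meets_r not_meets_avoids by (metis add.assoc)
  next
    case 3
    then show ?thesis
      using patternD(3)[OF p jK] r meets_r not_meets_avoids by (metis add.assoc)
  next
    case 4
    \<comment> \<open>The offset is below \<open>4 * K + 3\<close>, so block \<open>j\<close> is not
      the last and \<open>r + 1\<close> opens the next one.\<close>
    then have "Suc j \<le> K" using sn by simp
    moreover have "Suc r = s + 4 * Suc j" using r 4 by simp
    ultimately show ?thesis
      using patternD(1)[OF p, of "Suc j"] avoids_Suc_r not_meets_avoids by metis
  qed
  then show ?thesis by (simp add: n_def mod_eq_0_iff_dvd)
qed

section \<open>Counting occurrences of a colour\<close>

lemma color_occurrences:
  assumes p: "pattern K 0"
  shows "card {i. i < 4 * K + 3 \<and> c \<in> A i} \<le> K + 1"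
proof (cases "{i. i < 4 * K + 3 \<and> c \<in> A i} = {}")
  case True
  show ?thesis unfolding True by simp
next
  case False
  define I where "I = {i. i < 4 * K + 3 \<and> c \<in> A i}"
  define i0 where "i0 = Min I"
  have fin: "finite I" by (simp add: I_def)
  have i0: "i0 \<in> I" "\<And>i. i \<in> I \<Longrightarrow> i0 \<le> i"
    using False fin by (auto simp: i0_def I_def[symmetric])
  have not_av: "\<not> avoids (j - i)" if "i \<in> I" "j \<in> I" "i \<le> j" for i j
    using that avoidsD[of "j - i" i] by (auto simp: I_def)
  \<comment> \<open>Bucket \<open>g\<close> holds the offsets \<open>4 * g - 1\<close> to
    \<open>4 * g + 2\<close> from the first occurrence. Two occurrences in it differ by 3, as 1 and
    2 avoid; the later offset is then \<open>4 * g + 2\<close>, which avoids.\<close>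
  define g where "g i = (i - i0 + 1) div 4" for i
  have ne: "g i \<noteq> g j" if "i \<in> I" "j \<in> I" "i < j" for i j
  proof
    assume eq: "g i = g j"
    have "j - i \<noteq> 1" "j - i \<noteq> 2" using not_av[of i j] that avoids_1 avoids_2 by auto
    moreover have "4 * g i \<le> i - i0 + 1" by (simp add: g_def)
    moreover have "j - i0 + 1 < 4 + 4 * g j" unfolding g_def by (rule dividend_less_times_div) simp
    ultimately have "j - i0 = 4 * g j + 2" using eq i0(2)[OF that(1)] that(3) by linarith
    moreover have "j - i0 < 4 * K + 3" using that(2) by (auto simp: I_def)
    ultimately have "j - i0 = 4 * g j + 2" "g j \<le> K" by linarith+
    then have "avoids (j - i0)" using patternD(3)[OF p] by simp
    then show False using not_av[of i0 j] i0 that by blast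
  qed
  have "inj_on g I" using ne by (intro inj_onI) (metis linorder_neqE_nat)
  moreover have "g ` I \<subseteq> {..K}" by (auto simp: g_def I_def)
  ultimately have "card I \<le> card {..K}" using card_inj_on_le by blast
  then show ?thesis by (simp add: I_def)
qed

theorem ex_period:
  "\<exists>n. n dvd r \<and> n mod 4 = 3 \<and> 4 * n * b \<le> k * (n + 1)"
proof -
  obtain K where K: "pattern K 0" "avoids (4 * K + 4)" by (rule ex_first_pattern)
  define n where "n = 4 * K + 3"
  \<comment> \<open>Double counting of the pairs \<open>(i, c)\<close> with
    \<open>c \<in> A i\<close>; at the end \<open>4 * (K + 1) = n + 1\<close>.\<close>
  have "n * b = (\<Sum>i<n. card (A i))" by (simp add: card_A)
  also have "\<dots> = (\<Sum>i<n. \<Sum>c<k. if c \<in> A i then 1 else 0)"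
    using colors by (simp add: sum.If_cases Int_absorb1)
  also have "\<dots> = (\<Sum>c<k. \<Sum>i<n. if c \<in> A i then 1 else 0)" by (rule sum.swap)
  also have "\<dots> = (\<Sum>c<k. card {i. i < n \<and> c \<in> A i})"
    by (simp add: sum.If_cases lessThan_def Collect_conj_eq)
  also have "\<dots> \<le> (\<Sum>c<k. K + 1)"
    using color_occurrences[OF K(1)] by (intro sum_mono) (simp add: n_def)
  finally have "4 * n * b \<le> k * (n + 1)" by (simp add: n_def algebra_simps)
  moreover have "n mod 4 = 3" by (simp add: n_def)
  ultimately show ?thesis using period_dvd_r[OF K] n_def by blast
qed

end

section \<open>Lower bounds\<close>

lemma cyclic_coloring_of_bfold:
  assumes f: "bfold_oriented_coloring (cyc_V r) (cyc_A r) b k f" and r: "0 < r" and b: "0 < b"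
  shows "cyclic_coloring r b k (\<lambda>x. f (x mod r))"
proof
  have arc: "(x mod r, Suc x mod r) \<in> cyc_A r" for x
    using r unfolding cyc_A_def by (auto intro!: exI[of _ "x mod r"] simp: mod_Suc_eq)
  fix x z
  show "f (x mod r) \<subseteq> {..<k}" "card (f (x mod r)) = b"
    using f r by (auto simp: bfold_oriented_coloring_def cyc_V_def)
  show "f (x mod r) \<inter> f (Suc x mod r) = {}"
    using f arc[of x] by (auto simp: bfold_oriented_coloring_def)
  have "\<forall>(x, y)\<in>cyc_A r. \<forall>(z, w)\<in>cyc_A r. f x \<inter> f w \<noteq> {} \<longrightarrow> f y \<inter> f z = {}"
    using f by (simp add: bfold_oriented_coloring_def)
  then show "f (Suc x mod r) \<inter> f (z mod r) = {}" if "f (x mod r) \<inter> f (Suc z mod r) \<noteq> {}"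
    using that arc[of x] arc[of z] by fast
qed (use r b in simp_all)

text \<open>Residues 0, 1, 2 never multiply to 3 modulo 4, so a composite \<open>n\<close> has a
  smaller factor of the same kind.\<close>

lemma prime_factor_3_mod_4:
  fixes n :: nat
  assumes "n mod 4 = 3"
  shows "\<exists>p. prime p \<and> p dvd n \<and> p mod 4 = 3"
  using assms
proof (induction n rule: less_induct)
  case (less n)
  show ?case
  proof (cases "prime n")
    case True
    then show ?thesis using less.prems by (intro exI[of _ n]) simp
  next
    case False
    have "n \<noteq> 0" "n \<noteq> 1" using less.prems by (auto intro: Nat.gr0I)
    then have "n > 1" by simp
    then obtain a where a: "a dvd n" "a \<noteq> 1" "a \<noteq> n" using False by (auto simp: prime_nat_iff)
    then obtain c where ac: "n = a * c" by blast
    have lt: "a < n" using a \<open>n > 1\<close> by (simp add: dvd_imp_le le_neq_implies_less)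
    have lt': "c < n" using ac a(2) \<open>n > 1\<close> by (cases a; cases c) auto
    have "(a mod 4) * (c mod 4) mod 4 = 3" using less.prems ac by (simp add: mod_mult_eq)
    moreover have "a mod 4 < 4" "c mod 4 < 4" by simp_all
    moreover have "x = 3 \<or> y = 3" if xy: "x * y mod 4 = 3" "x < 4" "y < 4" for x y :: nat
    proof -
      consider "x = 0" | "x = 1" | "x = 2" | "x = 3" using xy(2) by linarith
      then show ?thesis
      proof cases
        case 3
        with xy(1) have "2 * y mod 4 = 3" by simp
        then show ?thesis by presburger
      qed (use xy in auto)
    qed
    ultimately have "a mod 4 = 3 \<or> c mod 4 = 3" by blast
    then show ?thesis using less.IH[OF lt] less.IH[OF lt'] ac by (metis dvd_mult dvd_mult2)
  qed
qed

text \<open>With \<open>k < 4 * b\<close>, the period \<open>n\<close> has a prime factor that is 3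
  modulo 4, and it is not 3 since 3 does not divide \<open>r\<close>. So the least type-A factor is
  at most \<open>n\<close>, and 4 - 4/(n+1) grows with \<open>n\<close>. The 4-cycle is covered
  too.\<close>

lemma four_minus_beta_le:
  assumes f: "bfold_oriented_coloring (cyc_V r) (cyc_A r) b k f"
    and r: "0 < r" "r mod 3 \<noteq> 0" and b: "0 < b"
  shows "(4 - beta r) * real b \<le> real k"
proof (cases "k < 4 * b")
  case False
  have "0 \<le> beta r" by (simp add: beta_def)
  then have "(4 - beta r) * real b \<le> 4 * real b" by (intro mult_right_mono) auto
  with False show ?thesis by linarith
next
  case True
  interpret cyclic_coloring r b k "\<lambda>x. f (x mod r)"
    by (rule cyclic_coloring_of_bfold[OF f r(1) b])
  interpret sparse_cyclic_coloring r b k "\<lambda>x. f (x mod r)"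
    by unfold_locales (rule True)
  obtain n where n: "n dvd r" "n mod 4 = 3" "4 * n * b \<le> k * (n + 1)" using ex_period by blast
  obtain p where p: "prime p" "p dvd n" "p mod 4 = 3" using prime_factor_3_mod_4[OF n(2)] by blast
  have pr: "p dvd r" using p(2) n(1) dvd_trans by blast
  then have "p \<noteq> 3" using r(2) by (auto simp: dvd_eq_mod_eq_0)
  moreover have "3 \<le> p" using p(3) by (metis mod_less_eq_dividend)
  ultimately have "typeA_prime p" using p by (simp add: typeA_prime_def)
  with pr have ex: "\<exists>p. typeA_prime p \<and> p dvd r" by blast
  define q where "q = (LEAST p. typeA_prime p \<and> p dvd r)"
  have "q \<le> p" unfolding q_def by (rule Least_le) (use \<open>typeA_prime p\<close> pr in blast)
  also have "p \<le> n" using p(2) n(2) by (intro dvd_imp_le) (auto intro: Nat.gr0I)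
  finally have "4 / (real n + 1) \<le> 4 / (real q + 1)" by (intro divide_left_mono) auto
  then have "4 - beta r \<le> 4 - 4 / (real n + 1)" using ex by (simp add: beta_def q_def)
  also have "\<dots> = 4 * real n / (real n + 1)" by (simp add: field_simps)
  finally have "(4 - beta r) * real b \<le> 4 * real n / (real n + 1) * real b"
    by (intro mult_right_mono) auto
  also have "\<dots> \<le> real k"
  proof -
    have "real (4 * n * b) \<le> real (k * (n + 1))" using n(3) of_nat_le_iff by blast
    then show ?thesis by (simp add: field_simps)
  qed
  finally show ?thesis .
qed

section \<open>Colourings\<close>

text \<open>\<open>D\<close> is an orientation of the colours respected by all arcs: a violation of
  (i) would give \<open>D c c\<close>, one of (ii) both \<open>D c d\<close> and
  \<open>D d c\<close>.\<close>

lemma bfold_oriented_coloringI: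
  assumes "\<And>v. v \<in> V \<Longrightarrow> f v \<subseteq> {..<k}" "\<And>v. v \<in> V \<Longrightarrow> card (f v) = b"
    and D: "\<And>x y c d. (x, y) \<in> E \<Longrightarrow> c \<in> f x \<Longrightarrow> d \<in> f y \<Longrightarrow> D c d"
    and asym: "\<And>c d. D c d \<Longrightarrow> \<not> D d c"
  shows "bfold_oriented_coloring V E b k f"
proof -
  have 1: "f x \<inter> f y = {}" if "(x, y) \<in> E" for x y
    using D[OF that] asym by blast
  have 2: "f y \<inter> f z = {}" if "(x, y) \<in> E" "(z, w) \<in> E" "f x \<inter> f w \<noteq> {}" for x y z w
    using D[OF that(1)] D[OF that(2)] that(3) asym by blast
  show ?thesis
    unfolding bfold_oriented_coloring_def
  proof (intro conjI)
    show "\<forall>v\<in>V. f v \<subseteq> {..<k} \<and> card (f v) = b" using assms(1,2) by blast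
    show "\<forall>(x, y)\<in>E. f x \<inter> f y = {}" using 1 by blast
    show "\<forall>(x, y)\<in>E. \<forall>(z, w)\<in>E. f x \<inter> f w \<noteq> {} \<longrightarrow> f y \<inter> f z = {}"
      using 2 by fast
  qed
qed

text \<open>Each vertex gets a private block of colours. This makes the minimum exist for every
  \<open>b\<close>; \<open>b = 1\<close> is optimal for the 4- and 5-cycles.\<close>

lemma ex_blowup_coloring:
  assumes "3 \<le> r"
  shows "\<exists>f. bfold_oriented_coloring (cyc_V r) (cyc_A r) b (r * b) f"
proof
  let ?f = "\<lambda>v. {v * b..<(v + 1) * b}"
  let ?D = "\<lambda>c d. c div b < r \<and> d div b = Suc (c div b) mod r"
  show "bfold_oriented_coloring (cyc_V r) (cyc_A r) b (r * b) ?f"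
  proof (rule bfold_oriented_coloringI[where D = ?D])
    fix v assume "v \<in> cyc_V r"
    then have "(v + 1) * b \<le> r * b" by (intro mult_right_mono) (auto simp: cyc_V_def)
    then show "?f v \<subseteq> {..<r * b}" by auto
    show "card (?f v) = b" by simp
  next
    fix x y c d assume "(x, y) \<in> cyc_A r" "c \<in> ?f x" "d \<in> ?f y"
    moreover have "c div b = v" if "c \<in> ?f v" for c v
      using that by (intro div_nat_eqI) (auto simp: ac_simps)
    ultimately show "?D c d" by (auto simp: cyc_A_def)
  next
    fix c d assume "?D c d"
    then show "\<not> ?D d c" using assms by (auto simp: mod_Suc split: if_splits)
  qed
qed

lemma ex_interval_coloring:
  assumes n: "n + 1 = 4 * m" and dvd: "n dvd r" and r: "0 < r"
  shows "\<exists>f. bfold_oriented_coloring (cyc_V r) (cyc_A r) m n f"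
proof
  let ?f = "\<lambda>x. (\<lambda>j. (m * x + j) mod n) ` {..<m}"
  \<comment> \<open>Along an arc the differences \<open>m + j - i\<close> lie between 1 and
    \<open>2 * m - 1\<close>; as \<open>n = 4 * m - 1\<close>, their negatives modulo
    \<open>n\<close> lie between \<open>2 * m\<close> and \<open>4 * m - 2\<close>.\<close>
  let ?D = "\<lambda>c d. (int d - int c) mod int n \<in> {1..2 * int m - 1}"
  have mn: "m \<le> n" "0 < n" using n by (cases m; simp)+
  show "bfold_oriented_coloring (cyc_V r) (cyc_A r) m n ?f"
  proof (rule bfold_oriented_coloringI[where D = ?D])
    fix v
    show "?f v \<subseteq> {..<n}" using mn by auto
    have "inj_on (\<lambda>j. (m * v + j) mod n) {..<m}"
    proof (rule inj_onI)
      fix i j assume ij: "i \<in> {..<m}" "j \<in> {..<m}" "(m * v + i) mod n = (m * v + j) mod n"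
      then have "(int (m * v) + int i) mod int n = (int (m * v) + int j) mod int n"
        by (metis of_nat_add zmod_int)
      then have "int i mod int n = int j mod int n"
        by (metis add_diff_cancel_left' mod_diff_left_eq)
      then show "i = j" using ij mn by simp
    qed
    then show "card (?f v) = m" by (simp add: card_image)
  next
    fix x y c d assume "(x, y) \<in> cyc_A r" and c: "c \<in> ?f x" and d: "d \<in> ?f y"
    then have y: "y = Suc x mod r" by (auto simp: cyc_A_def)
    obtain i j where i: "c = (m * x + i) mod n" "i < m" and j: "d = (m * y + j) mod n" "j < m"
      using c d by auto
    \<comment> \<open>The closing arc: since \<open>n\<close> divides \<open>r\<close>, reducing
      \<open>Suc x\<close> modulo \<open>r\<close> leaves the interval unchanged.\<close>
    have "m * y mod n = m * (y mod n) mod n" by (simp add: mod_mult_right_eq)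
    also have "y mod n = Suc x mod n" using y dvd by (simp add: mod_mod_cancel)
    finally have "m * y mod n = m * Suc x mod n" by (simp add: mod_mult_right_eq)
    then have d': "d = (m * Suc x + j) mod n" using j(1) by (metis mod_add_left_eq)
    have "(int d - int c) mod int n = (int (m * Suc x + j) - int (m * x + i)) mod int n"
      unfolding i(1) d' zmod_int by (rule mod_diff_eq)
    also have "int (m * Suc x + j) - int (m * x + i) = int m + int j - int i" by simp
    also have "\<dots> mod int n = int m + int j - int i"
      using i(2) j(2) n by (intro mod_pos_pos_trivial) linarith+
    finally show "?D c d" using i(2) j(2) by simp
  next
    fix c d assume D: "?D c d"
    have "(int c - int d) mod int n = int n - (int d - int c) mod int n"
      using D zmod_zminus1_eq_if[of "int d - int c" "int n"] by (simp split: if_splits)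
    then show "\<not> ?D d c" using D n by auto
  qed
qed

text \<open>With c = r mod 3, the colouring runs c times around the 4-cycle 0, 1, 2, 3 and then
  (r - 4 c) / 3 times around the triangle 0, 1, 2.\<close>

lemma ex_4_coloring:
  assumes "5 < r"
  shows "\<exists>f. bfold_oriented_coloring (cyc_V r) (cyc_A r) 1 4 f"
proof
  define c where "c = r mod 3"
  define a where "a = r div 3"
  have ra: "r = 3 * a + c" by (simp add: a_def c_def)
  have "c < 3" by (simp add: c_def)
  \<comment> \<open>The remainder exceeds the quotient only for \<open>r\<close> = 1, 2, 5.\<close>
  with ra assms have "c \<le> a" by linarith
  with ra have c: "4 * c \<le> r" "(r - 4 * c) mod 3 = 0" by (auto simp flip: diff_mult_distrib2)
  define g where "g i = (if i < 4 * c then i mod 4 else (i - 4 * c) mod 3)" for i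
  \<comment> \<open>The union of the arcs of both cycles; none occurs reversed.\<close>
  let ?D = "\<lambda>c d. (c, d) \<in> {(0, 1), (1, 2), (2, 0), (2, 3), (3, 0::nat)}"
  have step: "?D (g i) (g (Suc i))" for i
  proof -
    consider "Suc i < 4 * c" | "Suc i = 4 * c" | "4 * c \<le> i" by linarith
    then show ?thesis
    proof cases
      case 1
      then have "g i = i mod 4" "g (Suc i) = Suc i mod 4" by (auto simp: g_def)
      then show ?thesis by (auto simp: mod_Suc)
    next
      case 2
      then have "g i = 3" "g (Suc i) = 0" unfolding g_def by simp_all presburger
      then show ?thesis by simp
    next
      case 3
      then have "g i = (i - 4 * c) mod 3" "g (Suc i) = Suc (i - 4 * c) mod 3"
        by (auto simp: g_def Suc_diff_le)
      moreover have "(i - 4 * c) mod 3 < 3" by simp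
      then have "(i - 4 * c) mod 3 = 0 \<or> (i - 4 * c) mod 3 = 1 \<or> (i - 4 * c) mod 3 = 2" by linarith
      ultimately show ?thesis by (auto simp: mod_Suc)
    qed
  qed
  have g0: "g r = g 0" using c by (simp add: g_def)
  show "bfold_oriented_coloring (cyc_V r) (cyc_A r) 1 4 (\<lambda>i. {g i})"
  proof (rule bfold_oriented_coloringI[where D = ?D])
    fix v show "{g v} \<subseteq> {..<4}" using step[of v] by auto
  next
    fix x y c d assume "(x, y) \<in> cyc_A r" "c \<in> {g x}" "d \<in> {g y}"
    moreover have "g (Suc i mod r) = g (Suc i)" if "i < r" for i
      using that g0 by (cases "Suc i = r") auto
    ultimately show "?D c d" using step[of x] by (auto simp: cyc_A_def)
  qed auto
qed

section \<open>The fractional oriented chromatic number\<close>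

text \<open>The infimum is attained at \<open>b0\<close>; \<open>ex\<close> ensures that each
  \<open>LEAST\<close> is realised by a colouring.\<close>

lemma chi_o_star_eqI:
  assumes ex: "\<And>b. \<exists>k f. bfold_oriented_coloring V E b k f"
    and lower: "\<And>b k f. 0 < b \<Longrightarrow> bfold_oriented_coloring V E b k f \<Longrightarrow> L * real b \<le> real k"
    and upper: "bfold_oriented_coloring V E b0 k0 f0" "0 < b0" "real k0 = L * real b0"
  shows "chi_o_star V E = L"
proof -
  have "\<exists>f. bfold_oriented_coloring V E b (chi_o_b V E b) f" for b
    unfolding chi_o_b_def using ex[of b] by (rule LeastI_ex)
  then have low: "L \<le> real (chi_o_b V E b) / real b" if "1 \<le> b" for b
    using lower[of b] that by (auto simp: field_simps)
  have "chi_o_b V E b0 \<le> k0" unfolding chi_o_b_def using upper(1) by (intro Least_le) blast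
  then have "real (chi_o_b V E b0) / real b0 \<le> L"
    using upper(2,3) by (simp add: field_simps)
  show ?thesis unfolding chi_o_star_def
  proof (rule antisym)
    show "(INF b\<in>{b. 1 \<le> b}. real (chi_o_b V E b) / real b) \<le> L"
    proof (rule cINF_lower2)
      show "bdd_below ((\<lambda>b. real (chi_o_b V E b) / real b) ` {b. 1 \<le> b})"
        by (rule bdd_belowI[of _ 0]) auto
      show "b0 \<in> {b. 1 \<le> b}" using upper(2) by simp
    qed fact
    show "L \<le> (INF b\<in>{b. 1 \<le> b}. real (chi_o_b V E b) / real b)"
      using low by (intro cINF_greatest) auto
  qed
qed

theorem theorem5:
  fixes r :: nat
  assumes "r \<ge> 3"
  shows "(r mod 3 = 0 \<longrightarrow> chi_o_star (cyc_V r) (cyc_A r) = 3)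
       \<and> (r = 4 \<longrightarrow> chi_o_star (cyc_V r) (cyc_A r) = 4)
       \<and> (r = 5 \<longrightarrow> chi_o_star (cyc_V r) (cyc_A r) = 5)
       \<and> (r > 5 \<and> r mod 3 \<noteq> 0 \<longrightarrow> chi_o_star (cyc_V r) (cyc_A r) = 4 - beta r)"
proof (intro conjI impI)
  have r0: "0 < r" using assms by simp
  have ex: "\<exists>k f. bfold_oriented_coloring (cyc_V r) (cyc_A r) b k f" for b
    using ex_blowup_coloring[OF assms] by blast
  obtain f1 where f1: "bfold_oriented_coloring (cyc_V r) (cyc_A r) 1 r f1"
    using ex_blowup_coloring[OF assms, of 1] by auto
  show "chi_o_star (cyc_V r) (cyc_A r) = 3" if "r mod 3 = 0"
  proof -
    obtain f where f: "bfold_oriented_coloring (cyc_V r) (cyc_A r) 1 3 f"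
      using ex_interval_coloring[of 3 1 r] \<open>r mod 3 = 0\<close> r0 by auto
    show ?thesis
    proof (rule chi_o_star_eqI[OF ex _ f])
      fix b k f assume "0 < b" "bfold_oriented_coloring (cyc_V r) (cyc_A r) b k f"
      then show "3 * real b \<le> real k"
        using cyclic_coloring.three_sets_bound[OF cyclic_coloring_of_bfold[OF _ r0]] by fastforce
    qed auto
  qed
  show "chi_o_star (cyc_V r) (cyc_A r) = 5" if "r = 5"
  proof (rule chi_o_star_eqI[OF ex _ f1])
    fix b k f assume "0 < b" "bfold_oriented_coloring (cyc_V r) (cyc_A r) b k f"
    then show "5 * real b \<le> real k"
      using cyclic_coloring.five_sets_bound[OF cyclic_coloring_of_bfold[OF _ r0]] that by fastforce
  qed (use that in auto)
  have no_typeA: "beta r = 0" if "\<nexists>p. typeA_prime p \<and> p dvd r"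
    using that by (simp add: beta_def)
  show "chi_o_star (cyc_V r) (cyc_A r) = 4" if "r = 4"
  proof (rule chi_o_star_eqI[OF ex _ f1])
    \<comment> \<open>The only divisor of 4 above 3 is 4, which is not 3 modulo 4; so the general
      lower bound gives 4.\<close>
    have "\<not> p dvd 4" if "typeA_prime p" for p
    proof
      assume "p dvd 4"
      then have "p \<le> 4" by (rule dvd_imp_le) simp
      then have "p = 4" using that by (simp add: typeA_prime_def)
      then show False using that by (simp add: typeA_prime_def)
    qed
    then have "beta r = 0" using no_typeA \<open>r = 4\<close> by blast
    then show "4 * real b \<le> real k"
      if "0 < b" "bfold_oriented_coloring (cyc_V r) (cyc_A r) b k f" for b k f
      using four_minus_beta_le[OF that(2) r0 _ that(1)] \<open>r = 4\<close> by simp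
  qed (use that in auto)
  show "chi_o_star (cyc_V r) (cyc_A r) = 4 - beta r" if "r > 5 \<and> r mod 3 \<noteq> 0"
  proof -
    have lower: "(4 - beta r) * real b \<le> real k"
      if "0 < b" "bfold_oriented_coloring (cyc_V r) (cyc_A r) b k f" for b k f
      using four_minus_beta_le[OF that(2) r0 _ that(1)] \<open>r > 5 \<and> r mod 3 \<noteq> 0\<close> by simp
    show ?thesis
    proof (cases "\<exists>p. typeA_prime p \<and> p dvd r")
      case False
      obtain f where f: "bfold_oriented_coloring (cyc_V r) (cyc_A r) 1 4 f"
        using ex_4_coloring \<open>r > 5 \<and> r mod 3 \<noteq> 0\<close> by blast
      show ?thesis
        by (rule chi_o_star_eqI[OF ex lower f]) (use no_typeA[OF False] in auto)
    next
      case True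
      define p where "p = (LEAST p. typeA_prime p \<and> p dvd r)"
      have p: "typeA_prime p \<and> p dvd r" unfolding p_def using True by (rule LeastI_ex)
      \<comment> \<open>Chosen so that \<open>p = 4 * m - 1\<close>; the ratio is then
        \<open>p / m = 4 - 1 / m = 4 - 4 / (p + 1)\<close>.\<close>
      define m where "m = (p + 1) div 4"
      have "p mod 4 = 3" using p by (simp add: typeA_prime_def)
      then have m: "p + 1 = 4 * m" unfolding m_def by presburger
      obtain f where f: "bfold_oriented_coloring (cyc_V r) (cyc_A r) m p f"
        using ex_interval_coloring[OF m _ r0] p by blast
      have rm: "real p + 1 = 4 * real m" using m by (metis of_nat_1 of_nat_add of_nat_mult of_nat_numeral)
      have m0: "0 < m" using m by (cases m) auto
      have "beta r = 4 / (real p + 1)" using True by (simp add: beta_def p_def)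
      then have "beta r = 1 / real m" unfolding rm by simp
      then have "real p = (4 - beta r) * real m" using rm m0 by (simp add: field_simps)
      from chi_o_star_eqI[OF ex _ f m0 this] show ?thesis using lower by blast
    qed
  qed
qed

end
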